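(* Let $A\in\mathbb{M}_v(\mathbb{C})$ be a positive definite matrix. Then $$\left\|\sum_{k=1}^{v}\sqrt{k}\,A^{k}\right\|_2<\frac{v(v+1)(\sqrt{v}-0.5)\left(\|A\|_2-\left(\|A\|_2\right)^{v+1}\right)}{1-\|A\|_2}.$$
   Context: $\mathbb{M}_v(\mathbb{C})$ is the algebra of all $v\times v$ complex matrices. A Hermitian matrix $A\in\mathbb{M}_v(\mathbb{C})$ is positive definite if $x^*Ax>0$ for all $x\in\mathbb{C}^v$ with $x\neq 0$. $\|A\|_2=\left(\sum_{j=1}^v t_j^2(A)\right)^{1/2}$ is the Hilbert–Schmidt (Frobenius) norm, where $t_1(A)\ge\dots\ge t_v(A)$ are the singular values of $A$, i.e. the eigenvalues of $(A^*A)^{1/2}$ arranged in decreasing order and repeated according to multiplicity.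
   Formalization: The formal theorem assumes v ≥ 2 and ‖A‖₂ ≠ 1: for v = 1 and A = (a) with a > 0, a ≠ 1, both sides equal a, so the strict inequality fails, and for ‖A‖₂ = 1 the right-hand side divides by zero. *)

theory Defs
  imports
    "Jordan_Normal_Form.Schur_Decomposition"
    "HOL-Computational_Algebra.Fundamental_Theorem_Algebra"
begin

definition hermitian_mat :: "complex mat \<Rightarrow> bool" where
  "hermitian_mat A \<longleftrightarrow> square_mat A \<and> mat_adjoint A = A"

text \<open>
  The term \<open>(A *\<^sub>v x) \<bullet>c x\<close> is $x^* A x$. The order on complex numbers is the one
  of \<^theory>\<open>HOL-Library.Complex_Order\<close>: \<open>0 < z\<close> means that \<open>z\<close> is real and positive.
\<close>

definition pos_def_mat :: "complex mat \<Rightarrow> bool" where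
  "pos_def_mat A \<longleftrightarrow> hermitian_mat A \<and>
     (\<forall>x \<in> carrier_vec (dim_row A). x \<noteq> 0\<^sub>v (dim_row A) \<longrightarrow> 0 < (A *\<^sub>v x) \<bullet>c x)"

definition pos_semidef_mat :: "complex mat \<Rightarrow> bool" where
  "pos_semidef_mat A \<longleftrightarrow> hermitian_mat A \<and>
     (\<forall>x \<in> carrier_vec (dim_row A). 0 \<le> (A *\<^sub>v x) \<bullet>c x)"

text \<open>The positive semidefinite square root, meaningful when \<open>P\<close> is positive semidefinite.\<close>

definition mat_sqrt :: "complex mat \<Rightarrow> complex mat" where
  "mat_sqrt P = (THE B. B \<in> carrier_mat (dim_row P) (dim_row P) \<and> pos_semidef_mat B \<and> B * B = P)"

text \<open>
  The eigenvalues of $(A^*A)^{1/2}$ in decreasing order. Multiplicities are those of the roots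
  of the characteristic polynomial; since that matrix is Hermitian, they agree with the
  geometric multiplicities, and taking real parts loses nothing.
\<close>

definition singular_values :: "complex mat \<Rightarrow> real list" where
  "singular_values A =
     rev (sorted_list_of_multiset
       (image_mset Re (proots (char_poly (mat_sqrt (mat_adjoint A * A))))))"

text \<open>The Hilbert--Schmidt norm of a square matrix; list positions start at 0.\<close>

definition hs_norm :: "complex mat \<Rightarrow> real" where
  "hs_norm A = sqrt (\<Sum>j<dim_row A. (singular_values A ! j)\<^sup>2)"

end

theory Submission
  imports Defs "HOL-Analysis.L2_Norm"
begin

text \<open>
  Both \<open>A\<close> and \<open>\<Sum> \<surd>k A\<^sup>k\<close> are positive semidefinite, so each is its own absolute value and
  its singular values are its eigenvalues. The squares of these sum to the trace of the square of
  the matrix, hence the Hilbert--Schmidt norm is the entrywise Frobenius norm. By the triangle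
  inequality and submultiplicativity the left side is at most \<open>\<surd>v \<Sum> a\<^sup>k\<close> with \<open>a = \<parallel>A\<parallel>\<^sub>2\<close>; the
  right side is \<open>v (v + 1) (\<surd>v - 1/2) \<Sum> a\<^sup>k\<close>, which is larger since \<open>v (v + 1) \<ge> 6\<close> and \<open>a > 0\<close>.
\<close>

section \<open>Entrywise formulas and Hermitian symmetry\<close>

lemma index_mat_adjoint:
  assumes "i < dim_col A" "j < dim_row A"
  shows "mat_adjoint A $$ (i, j) = conjugate (A $$ (j, i))"
  using assms unfolding mat_adjoint_def by (simp add: mat_of_rows_index)

lemma hermitian_mat_iff:
  assumes "A \<in> carrier_mat n n"
  shows "hermitian_mat A \<longleftrightarrow> (\<forall>i<n. \<forall>j<n. cnj (A $$ (j, i)) = A $$ (i, j))"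
proof -
  have dim: "dim_row (mat_adjoint A) = n" "dim_col (mat_adjoint A) = n"
    using assms by (auto simp: mat_adjoint_def)
  have "mat_adjoint A = A \<longleftrightarrow> (\<forall>i<n. \<forall>j<n. mat_adjoint A $$ (i, j) = A $$ (i, j))"
    using assms dim by (metis carrier_matD eq_matI)
  then show ?thesis
    using assms by (auto simp: hermitian_mat_def index_mat_adjoint)
qed

lemma cscalar_prod_sum:
  assumes "x \<in> carrier_vec n" "y \<in> carrier_vec n"
  shows "x \<bullet>c y = (\<Sum>i<n. x $ i * cnj (y $ i))"
  using assms by (simp add: scalar_prod_def atLeast0LessThan)

lemma mult_mat_vec_sum:
  assumes "A \<in> carrier_mat m n" "x \<in> carrier_vec n" "i < m"
  shows "(A *\<^sub>v x) $ i = (\<Sum>j<n. A $$ (i, j) * x $ j)"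
  using assms by (simp add: scalar_prod_def atLeast0LessThan)

lemma mult_mat_sum:
  assumes "A \<in> carrier_mat m n" "B \<in> carrier_mat n l" "i < m" "j < l"
  shows "(A * B) $$ (i, j) = (\<Sum>k<n. A $$ (i, k) * B $$ (k, j))"
  using assms by (simp add: scalar_prod_def atLeast0LessThan)

text \<open>The form in which Hermitian symmetry is used later: for real eigenvalues, for uniqueness
  of square roots and for positivity of powers.\<close>

lemma hermitian_mat_swap:
  assumes A: "A \<in> carrier_mat n n" and "hermitian_mat A"
    and x: "x \<in> carrier_vec n" and y: "y \<in> carrier_vec n"
  shows "(A *\<^sub>v x) \<bullet>c y = x \<bullet>c (A *\<^sub>v y)"
proof -
  have h: "cnj (A $$ (j, i)) = A $$ (i, j)" if "i < n" "j < n" for i j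
    using assms that hermitian_mat_iff by blast
  have "(A *\<^sub>v x) \<bullet>c y = (\<Sum>i<n. \<Sum>j<n. A $$ (i, j) * x $ j * cnj (y $ i))"
    using A x y by (simp add: cscalar_prod_sum[of _ n] mult_mat_vec_sum[of A n n] sum_distrib_right
        del: index_mult_mat_vec)
  also have "\<dots> = (\<Sum>j<n. \<Sum>i<n. A $$ (i, j) * x $ j * cnj (y $ i))"
    by (rule sum.swap)
  also have "\<dots> = (\<Sum>j<n. \<Sum>i<n. x $ j * cnj (A $$ (j, i) * y $ i))"
  proof (intro sum.cong refl)
    fix i j assume "i \<in> {..<n}" "j \<in> {..<n}"
    then show "A $$ (i, j) * x $ j * cnj (y $ i) = x $ j * cnj (A $$ (j, i) * y $ i)"
      using h[of i j] by simp
  qed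
  also have "\<dots> = x \<bullet>c (A *\<^sub>v y)"
    using A x y by (simp add: cscalar_prod_sum[of _ n] mult_mat_vec_sum[of A n n] sum_distrib_left
        del: index_mult_mat_vec)
  finally show ?thesis .
qed

text \<open>Self-adjointness lets the eigenvalue be taken out of either argument of the inner
  product, once as \<open>e\<close> and once as \<open>cnj e\<close>.\<close>

lemma hermitian_mat_eigenvalue_real:
  assumes A: "A \<in> carrier_mat n n" and "hermitian_mat A" and "eigenvalue A e"
  shows "e \<in> \<real>"
proof -
  obtain x where x: "x \<in> carrier_vec n" "x \<noteq> 0\<^sub>v n" "A *\<^sub>v x = e \<cdot>\<^sub>v x"
    using assms unfolding eigenvalue_def eigenvector_def by auto
  have "(A *\<^sub>v x) \<bullet>c x = x \<bullet>c (A *\<^sub>v x)"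
    using hermitian_mat_swap assms x by blast
  then have "e * (x \<bullet>c x) = cnj e * (x \<bullet>c x)"
    using x by (simp add: conjugate_smult_vec)
  moreover have "x \<bullet>c x \<noteq> 0"
    using x by simp
  ultimately show ?thesis
    by (simp add: Reals_cnj_iff)
qed

section \<open>Traces and roots of the characteristic polynomial\<close>

lemma trace_mult_comm:
  fixes A :: "'a :: comm_semiring_0 mat"
  assumes "A \<in> carrier_mat n m" "B \<in> carrier_mat m n"
  shows "(\<Sum>i<n. (A * B) $$ (i, i)) = (\<Sum>i<m. (B * A) $$ (i, i))"
proof -
  have "(\<Sum>i<n. (A * B) $$ (i, i)) = (\<Sum>i<n. \<Sum>k<m. A $$ (i, k) * B $$ (k, i))"
    using assms by (intro sum.cong refl mult_mat_sum) auto
  also have "\<dots> = (\<Sum>k<m. \<Sum>i<n. B $$ (k, i) * A $$ (i, k))"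
    by (subst sum.swap) (simp add: mult.commute)
  also have "\<dots> = (\<Sum>i<m. (B * A) $$ (i, i))"
    using assms by (intro sum.cong refl mult_mat_sum[symmetric]) auto
  finally show ?thesis .
qed

lemma char_poly_factorization:
  fixes A :: "complex mat"
  assumes A: "A \<in> carrier_mat n n"
  shows "char_poly A = (\<Prod>e\<in>#proots (char_poly A). [:- e, 1:])"
  using complex_poly_decompose_multiset[of "char_poly A"] degree_monic_char_poly[OF A] by simp

lemma size_proots_char_poly:
  fixes A :: "complex mat"
  assumes A: "A \<in> carrier_mat n n"
  shows "size (proots (char_poly A)) = n"
  using size_proots_complex[of "char_poly A"] degree_monic_char_poly[OF A] by simp

text \<open>Schur decomposition makes \<open>A\<close> similar to an upper triangular
  \<open>B\<close> whose diagonal lists the roots. The trace of a square is invariant under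
  similarity, and the diagonal of \<open>B * B\<close> consists of the squared diagonal entries of
  \<open>B\<close>.\<close>

lemma sum_proots_char_poly_power2:
  fixes A :: "complex mat"
  assumes A: "A \<in> carrier_mat n n"
  shows "(\<Sum>e\<in>#proots (char_poly A). e\<^sup>2) = (\<Sum>i<n. (A * A) $$ (i, i))"
proof -
  obtain es where es: "mset es = proots (char_poly A)"
    using ex_mset by blast
  have cp: "char_poly A = (\<Prod>e\<leftarrow>es. [:- e, 1:])"
    using char_poly_factorization[OF A] by (simp flip: es prod_mset_prod_list)
  obtain B P Q where "schur_decomposition A es = (B, P, Q)"
    by (cases "schur_decomposition A es")
  from schur_decomposition[OF A cp this]
  have sim: "similar_mat_wit A B P Q" and tri: "upper_triangular B" and diag: "diag_mat B = es"
    by auto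
  note S = similar_mat_witD2[OF A sim]
  have B: "B \<in> carrier_mat n n" and P: "P \<in> carrier_mat n n" and Q: "Q \<in> carrier_mat n n"
    using S by auto
  have "A * A = P * (B * B) * Q"
    using similar_mat_wit_pow_id[OF sim, of 2] A B by (simp add: numeral_2_eq_2)
  then have "(\<Sum>i<n. (A * A) $$ (i, i)) = (\<Sum>i<n. (Q * (P * (B * B))) $$ (i, i))"
    using trace_mult_comm[of "P * (B * B)" n n Q] B P Q by simp
  \<comment> \<open>The trace was rotated cyclically to bring \<open>Q\<close> next to
    \<open>P\<close>; \<open>S(2)\<close> is \<open>Q * P = 1\<^sub>m n\<close>.\<close>
  also have "Q * (P * (B * B)) = B * B"
    using B P Q S(2) by (simp flip: assoc_mult_mat[of Q n n P n "B * B" n])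
  also have "(\<Sum>i<n. (B * B) $$ (i, i)) = (\<Sum>i<n. (B $$ (i, i))\<^sup>2)"
  proof (intro sum.cong refl)
    fix i assume "i \<in> {..<n}"
    then have i: "i < n" by simp
    have "(B * B) $$ (i, i) = (\<Sum>k<n. B $$ (i, k) * B $$ (k, i))"
      using B i mult_mat_sum by blast
    \<comment> \<open>For \<open>k \<noteq> i\<close> one of the two factors lies strictly below the
      diagonal.\<close>
    also have "\<dots> = (\<Sum>k<n. if k = i then (B $$ (i, i))\<^sup>2 else 0)"
    proof (intro sum.cong refl)
      fix k assume "k \<in> {..<n}"
      then show "B $$ (i, k) * B $$ (k, i) = (if k = i then (B $$ (i, i))\<^sup>2 else 0)"
        using upper_triangularD[OF tri, of k i] upper_triangularD[OF tri, of i k] B i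
        by (cases k i rule: linorder_cases) (auto simp: power2_eq_square)
    qed
    also have "\<dots> = (B $$ (i, i))\<^sup>2"
      using i by simp
    finally show "(B * B) $$ (i, i) = (B $$ (i, i))\<^sup>2" .
  qed
  also have "\<dots> = (\<Sum>e\<leftarrow>es. e\<^sup>2)"
    using B by (simp add: diag[symmetric] diag_mat_def o_def interv_sum_list_conv_sum_set_nat
        atLeast0LessThan)
  also have "\<dots> = (\<Sum>e\<in>#proots (char_poly A). e\<^sup>2)"
    by (simp flip: es sum_mset_sum_list)
  finally show ?thesis by simp
qed

section \<open>The Frobenius norm\<close>

text \<open>A single \<open>L2_set\<close> over index pairs makes the triangle inequality an
  instance of Minkowski's inequality \<open>L2_set_triangle_ineq\<close>.\<close>

definition frobenius_norm :: "complex mat \<Rightarrow> real" where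
  "frobenius_norm A =
     L2_set (\<lambda>(i, j). cmod (A $$ (i, j))) ({..<dim_row A} \<times> {..<dim_col A})"

lemma frobenius_norm_power2:
  "(frobenius_norm A)\<^sup>2 = (\<Sum>i<dim_row A. \<Sum>j<dim_col A. (cmod (A $$ (i, j)))\<^sup>2)"
  by (simp add: frobenius_norm_def L2_set_def sum_nonneg sum.cartesian_product case_prod_unfold)

lemma frobenius_norm_nonneg: "0 \<le> frobenius_norm A"
  by (simp add: frobenius_norm_def)

lemma frobenius_norm_eq_0_iff:
  assumes "A \<in> carrier_mat n m"
  shows "frobenius_norm A = 0 \<longleftrightarrow> A = 0\<^sub>m n m"
  using assms by (auto simp: frobenius_norm_def L2_set_eq_0_iff mat_eq_iff)

lemma frobenius_norm_add:
  assumes "A \<in> carrier_mat n m" "B \<in> carrier_mat n m"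
  shows "frobenius_norm (A + B) \<le> frobenius_norm A + frobenius_norm B"
proof -
  let ?I = "{..<n} \<times> {..<m}"
  have "frobenius_norm (A + B)
      \<le> L2_set (\<lambda>p. (case p of (i, j) \<Rightarrow> cmod (A $$ (i, j))) + (case p of (i, j) \<Rightarrow> cmod (B $$ (i, j)))) ?I"
    using assms unfolding frobenius_norm_def
    by (auto intro!: L2_set_mono norm_triangle_ineq)
  also have "\<dots> \<le> frobenius_norm A + frobenius_norm B"
    using assms unfolding frobenius_norm_def by (simp only: carrier_matD L2_set_triangle_ineq)
  finally show ?thesis .
qed

lemma frobenius_norm_smult: "frobenius_norm (c \<cdot>\<^sub>m A) = cmod c * frobenius_norm A"
  unfolding frobenius_norm_def
  by (subst L2_set_right_distrib) (auto intro!: L2_set_cong simp: norm_mult)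

text \<open>By Cauchy-Schwarz each squared entry of the product is at most the squared norm of a row
  of \<open>A\<close> times that of a column of \<open>B\<close>; the double sum of these bounds
  factorizes.\<close>

lemma frobenius_norm_mult:
  assumes A: "A \<in> carrier_mat n m" and B: "B \<in> carrier_mat m l"
  shows "frobenius_norm (A * B) \<le> frobenius_norm A * frobenius_norm B"
proof (rule power2_le_imp_le)
  let ?r = "\<lambda>i. \<Sum>k<m. (cmod (A $$ (i, k)))\<^sup>2" and ?c = "\<lambda>j. \<Sum>k<m. (cmod (B $$ (k, j)))\<^sup>2"
  have entry: "(cmod ((A * B) $$ (i, j)))\<^sup>2 \<le> ?r i * ?c j" if "i < n" "j < l" for i j
  proof -
    have "cmod ((A * B) $$ (i, j)) = cmod (\<Sum>k<m. A $$ (i, k) * B $$ (k, j))"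
      using mult_mat_sum[OF A B that] by simp
    also have "\<dots> \<le> (\<Sum>k<m. \<bar>cmod (A $$ (i, k))\<bar> * \<bar>cmod (B $$ (k, j))\<bar>)"
      by (rule order_trans[OF norm_sum]) (simp add: norm_mult)
    also have "\<dots> \<le> L2_set (\<lambda>k. cmod (A $$ (i, k))) {..<m} * L2_set (\<lambda>k. cmod (B $$ (k, j))) {..<m}"
      by (rule L2_set_mult_ineq)
    finally have "(cmod ((A * B) $$ (i, j)))\<^sup>2
        \<le> (L2_set (\<lambda>k. cmod (A $$ (i, k))) {..<m} * L2_set (\<lambda>k. cmod (B $$ (k, j))) {..<m})\<^sup>2"
      by (rule power_mono) simp
    then show ?thesis
      by (simp add: power_mult_distrib L2_set_def sum_nonneg)
  qed
  have "(frobenius_norm (A * B))\<^sup>2 = (\<Sum>i<n. \<Sum>j<l. (cmod ((A * B) $$ (i, j)))\<^sup>2)"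
    using A B by (simp add: frobenius_norm_power2 del: index_mult_mat(1))
  also have "\<dots> \<le> (\<Sum>i<n. \<Sum>j<l. ?r i * ?c j)"
    using entry by (intro sum_mono) simp
  also have "\<dots> = (\<Sum>i<n. ?r i) * (\<Sum>j<l. ?c j)"
    by (simp add: sum_product)
  also have "(\<Sum>j<l. ?c j) = (\<Sum>k<m. \<Sum>j<l. (cmod (B $$ (k, j)))\<^sup>2)"
    by (rule sum.swap)
  also have "(\<Sum>i<n. ?r i) * \<dots> = (frobenius_norm A * frobenius_norm B)\<^sup>2"
    using A B by (simp add: frobenius_norm_power2 power_mult_distrib)
  finally show "(frobenius_norm (A * B))\<^sup>2 \<le> (frobenius_norm A * frobenius_norm B)\<^sup>2" .
  show "0 \<le> frobenius_norm A * frobenius_norm B"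
    by (simp add: frobenius_norm_nonneg)
qed

text \<open>The induction starts at 1 because the identity matrix has norm \<open>sqrt n\<close>,
  which exceeds 1 for \<open>n \<ge> 2\<close>.\<close>

lemma frobenius_norm_pow:
  assumes A: "A \<in> carrier_mat n n" and "k \<ge> 1"
  shows "frobenius_norm (A ^\<^sub>m k) \<le> frobenius_norm A ^ k"
  using \<open>k \<ge> 1\<close>
proof (induction k rule: dec_induct)
  case base
  then show ?case using A by simp
next
  case (step k)
  have "frobenius_norm (A ^\<^sub>m Suc k) \<le> frobenius_norm (A ^\<^sub>m k) * frobenius_norm A"
    using A frobenius_norm_mult[of "A ^\<^sub>m k" n n A n] by simp
  also have "\<dots> \<le> frobenius_norm A ^ k * frobenius_norm A"
    using step frobenius_norm_nonneg by (intro mult_right_mono)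
  finally show ?case by (simp add: mult.commute)
qed

section \<open>Spectrum and square roots of Hermitian matrices\<close>

text \<open>Symmetry turns \<open>A $$ (i, j) * A $$ (j, i)\<close> into a squared modulus. Together
  with \<open>sum_proots_char_poly_power2\<close> this links eigenvalues to entries without
  diagonalizing \<open>A\<close>.\<close>

lemma hermitian_mat_trace_power2:
  assumes A: "A \<in> carrier_mat n n" and "hermitian_mat A"
  shows "(\<Sum>i<n. (A * A) $$ (i, i)) = of_real ((frobenius_norm A)\<^sup>2)"
proof -
  have h: "cnj (A $$ (j, i)) = A $$ (i, j)" if "i < n" "j < n" for i j
    using assms that hermitian_mat_iff by blast
  have "(\<Sum>i<n. (A * A) $$ (i, i)) = (\<Sum>i<n. \<Sum>j<n. A $$ (i, j) * A $$ (j, i))"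
    using A by (intro sum.cong refl mult_mat_sum) auto
  also have "\<dots> = (\<Sum>i<n. \<Sum>j<n. of_real ((cmod (A $$ (i, j)))\<^sup>2))"
  proof (intro sum.cong refl)
    fix i j assume "i \<in> {..<n}" "j \<in> {..<n}"
    then show "A $$ (i, j) * A $$ (j, i) = of_real ((cmod (A $$ (i, j)))\<^sup>2)"
      using h[of j i] complex_norm_square[of "A $$ (i, j)"] by simp
  qed
  also have "\<dots> = of_real ((frobenius_norm A)\<^sup>2)"
    using A by (simp add: frobenius_norm_power2)
  finally show ?thesis .
qed

lemma proots_char_poly_iff_eigenvalue:
  fixes A :: "complex mat"
  assumes A: "A \<in> carrier_mat n n"
  shows "e \<in># proots (char_poly A) \<longleftrightarrow> eigenvalue A e"
proof -
  have "char_poly A \<noteq> 0"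
    using degree_monic_char_poly[OF A] by auto
  then show ?thesis
    using eigenvalue_root_char_poly[OF A] by simp
qed

text \<open>If every eigenvalue were 0, so would be the sum of their squares, which is the squared
  Frobenius norm.\<close>

lemma hermitian_mat_nonzero_eigenvalue:
  assumes A: "A \<in> carrier_mat n n" and h: "hermitian_mat A" and "A \<noteq> 0\<^sub>m n n"
  obtains e where "eigenvalue A e" "e \<noteq> 0"
proof (rule ccontr)
  assume "\<not> thesis"
  then have "e = 0" if "e \<in># proots (char_poly A)" for e
    using that proots_char_poly_iff_eigenvalue[OF A] \<open>\<And>e. eigenvalue A e \<Longrightarrow> e \<noteq> 0 \<Longrightarrow> thesis\<close> by blast
  then have "(\<Sum>e\<in>#proots (char_poly A). e\<^sup>2) = 0"
    by (intro sum_mset.neutral) auto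
  then have "frobenius_norm A = 0"
    using sum_proots_char_poly_power2[OF A] hermitian_mat_trace_power2[OF A h] by simp
  then show False
    using frobenius_norm_eq_0_iff[OF A] \<open>A \<noteq> 0\<^sub>m n n\<close> by simp
qed

text \<open>
  For \<open>D = B - C\<close> the hypothesis gives \<open>D * B + C * D = 0\<close>. On an eigenvector \<open>x\<close> of \<open>D\<close> with
  eigenvalue \<open>e \<noteq> 0\<close> this forces \<open>\<langle>B x, x\<rangle> + \<langle>C x, x\<rangle> = 0\<close>, so both terms vanish, while their
  difference is \<open>e\<close> times \<open>\<langle>x, x\<rangle>\<close>.
\<close>

lemma pos_semidef_mat_sqrt_unique:
  assumes B: "B \<in> carrier_mat n n" "pos_semidef_mat B"
    and C: "C \<in> carrier_mat n n" "pos_semidef_mat C"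
    and eq: "B * B = C * C"
  shows "B = C"
proof (rule ccontr)
  assume "B \<noteq> C"
  define D where "D = B - C"
  have D: "D \<in> carrier_mat n n"
    using B C by (auto simp: D_def)
  have hB: "hermitian_mat B" and hC: "hermitian_mat C"
    using B C by (auto simp: pos_semidef_mat_def)
  have hD: "hermitian_mat D"
    using hB hC B(1) C(1) unfolding hermitian_mat_iff[OF D] hermitian_mat_iff[OF B(1)]
      hermitian_mat_iff[OF C(1)] by (auto simp: D_def)
  have "D \<noteq> 0\<^sub>m n n"
  proof
    assume "D = 0\<^sub>m n n"
    then have "B $$ (i, j) - C $$ (i, j) = 0" if "i < n" "j < n" for i j
      using that B C by (metis D_def carrier_matD index_minus_mat(1) index_zero_mat(1))
    then have "B = C"
      using B C by (intro eq_matI) auto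
    with \<open>B \<noteq> C\<close> show False ..
  qed
  then obtain e where "eigenvalue D e" and e: "e \<noteq> 0"
    using hermitian_mat_nonzero_eigenvalue[OF D hD] by blast
  then obtain x where x: "x \<in> carrier_vec n" "x \<noteq> 0\<^sub>v n" "D *\<^sub>v x = e \<cdot>\<^sub>v x"
    using D unfolding eigenvalue_def eigenvector_def by auto
  have Dx: "D *\<^sub>v y = B *\<^sub>v y - C *\<^sub>v y" if "y \<in> carrier_vec n" for y
    using B C that by (simp add: D_def minus_mult_distrib_mat_vec)
  have Bx: "B *\<^sub>v x \<in> carrier_vec n" and Cx: "C *\<^sub>v x \<in> carrier_vec n"
    using B C x by auto
  have real: "e \<in> \<real>"
    using hermitian_mat_eigenvalue_real D hD \<open>eigenvalue D e\<close> by blast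
  have sq: "B *\<^sub>v (B *\<^sub>v x) = C *\<^sub>v (C *\<^sub>v x)"
    using B C x eq by (metis assoc_mult_mat_vec)
  \<comment> \<open>Since \<open>e\<close> is real, it leaves the conjugate-linear second argument
    unchanged.\<close>
  have "e * ((B *\<^sub>v x) \<bullet>c x) = (B *\<^sub>v x) \<bullet>c (D *\<^sub>v x)"
    using x Bx real by (simp add: conjugate_smult_vec Reals_cnj_iff)
  also have "\<dots> = (D *\<^sub>v (B *\<^sub>v x)) \<bullet>c x"
    using hermitian_mat_swap[OF D hD Bx x(1)] by simp
  also have "\<dots> = (B *\<^sub>v (B *\<^sub>v x)) \<bullet>c x - (C *\<^sub>v (B *\<^sub>v x)) \<bullet>c x"
    unfolding Dx[OF Bx] using B C Bx x by (intro minus_scalar_prod_distrib[of _ n]) auto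
  finally have 1: "e * ((B *\<^sub>v x) \<bullet>c x) = (B *\<^sub>v (B *\<^sub>v x)) \<bullet>c x - (C *\<^sub>v (B *\<^sub>v x)) \<bullet>c x" .
  have "e * ((C *\<^sub>v x) \<bullet>c x) = (C *\<^sub>v (D *\<^sub>v x)) \<bullet>c x"
    using C Cx x by (simp add: mult_mat_vec)
  also have "C *\<^sub>v (D *\<^sub>v x) = C *\<^sub>v (B *\<^sub>v x) - C *\<^sub>v (C *\<^sub>v x)"
    unfolding Dx[OF x(1)] using C Bx Cx by (intro mult_minus_distrib_mat_vec)
  also have "\<dots> \<bullet>c x = (C *\<^sub>v (B *\<^sub>v x)) \<bullet>c x - (C *\<^sub>v (C *\<^sub>v x)) \<bullet>c x"
    using C Bx Cx x by (intro minus_scalar_prod_distrib[of _ n]) auto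
  \<comment> \<open>Adding the two identities cancels the mixed terms with
    \<open>C *\<^sub>v (B *\<^sub>v x)\<close>, and \<open>sq\<close> cancels the rest.\<close>
  finally have "e * ((B *\<^sub>v x) \<bullet>c x + (C *\<^sub>v x) \<bullet>c x) = 0"
    using 1 sq by (simp add: distrib_left)
  then have sum0: "(B *\<^sub>v x) \<bullet>c x + (C *\<^sub>v x) \<bullet>c x = 0"
    using e by simp
  have pos: "0 \<le> (B *\<^sub>v x) \<bullet>c x" "0 \<le> (C *\<^sub>v x) \<bullet>c x"
    using B C x by (auto simp: pos_semidef_mat_def)
  have "(B *\<^sub>v x) \<bullet>c x = 0" "(C *\<^sub>v x) \<bullet>c x = 0"
    using add_nonneg_eq_0_iff[OF pos] sum0 by auto
  moreover have "(D *\<^sub>v x) \<bullet>c x = (B *\<^sub>v x) \<bullet>c x - (C *\<^sub>v x) \<bullet>c x"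
    unfolding Dx[OF x(1)] using Bx Cx x by (intro minus_scalar_prod_distrib[of _ n]) auto
  moreover have "(D *\<^sub>v x) \<bullet>c x = e * (x \<bullet>c x)"
    using x by simp
  ultimately have "x \<bullet>c x = 0"
    using e by simp
  then show False
    using x by simp
qed

section \<open>Hilbert-Schmidt norm of positive semidefinite matrices\<close>

text \<open>Resolves the definite description in \<open>mat_sqrt\<close>: \<open>A\<close> is itself
  a semidefinite root of \<open>A * A\<close>, and there is only one.\<close>

lemma mat_sqrt_power2:
  assumes A: "A \<in> carrier_mat n n" and "pos_semidef_mat A"
  shows "mat_sqrt (A * A) = A"
  unfolding mat_sqrt_def
  using assms pos_semidef_mat_sqrt_unique[of _ n A] by (intro the_equality) auto

lemma Re_sum_mset_of_real: "Re (\<Sum>x\<in>#M. of_real (f x)) = (\<Sum>x\<in>#M. f x)"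
  by (induction M) simp_all

lemma hs_norm_pos_semidef:
  assumes A: "A \<in> carrier_mat n n" and psd: "pos_semidef_mat A"
  shows "hs_norm A = frobenius_norm A"
proof -
  let ?M = "proots (char_poly A)"
  have h: "hermitian_mat A"
    using psd by (simp add: pos_semidef_mat_def)
  then have "mat_sqrt (mat_adjoint A * A) = A"
    using mat_sqrt_power2[OF A psd] by (simp add: hermitian_mat_def)
  then have mset: "mset (singular_values A) = image_mset Re ?M"
    by (simp add: singular_values_def)
  \<comment> \<open>The length matters because \<open>hs_norm\<close> reads the list at every
    position below \<open>dim_row A\<close>.\<close>
  then have "length (singular_values A) = n"
    using size_proots_char_poly[OF A] by (metis size_image_mset size_mset)
  then have "(\<Sum>j<dim_row A. (singular_values A ! j)\<^sup>2) = (\<Sum>t\<leftarrow>singular_values A. t\<^sup>2)"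
    using A by (simp add: sum_list_sum_nth atLeast0LessThan)
  also have "\<dots> = (\<Sum>t\<in>#image_mset Re ?M. t\<^sup>2)"
    by (simp flip: mset sum_mset_sum_list)
  also have "\<dots> = Re (\<Sum>e\<in>#?M. e\<^sup>2)"
  proof -
    \<comment> \<open>Eigenvalues are real here, so squaring commutes with taking real
      parts.\<close>
    have "of_real (Re e) = e" if "e \<in># ?M" for e
      using that proots_char_poly_iff_eigenvalue[OF A] hermitian_mat_eigenvalue_real[OF A h]
      by (simp add: complex_is_Real_iff complex_eq_iff)
    then have "(\<Sum>e\<in>#?M. e\<^sup>2) = (\<Sum>e\<in>#?M. of_real ((Re e)\<^sup>2))"
      by (intro arg_cong[where f = sum_mset] image_mset_cong) (metis of_real_power)
    also have "Re \<dots> = (\<Sum>e\<in>#?M. (Re e)\<^sup>2)"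
      by (rule Re_sum_mset_of_real)
    finally show ?thesis by (simp add: image_mset.compositionality o_def)
  qed
  also have "\<dots> = (frobenius_norm A)\<^sup>2"
    by (simp add: sum_proots_char_poly_power2[OF A] hermitian_mat_trace_power2[OF A h]
        del: of_real_power)
  finally show ?thesis
    by (simp add: hs_norm_def frobenius_norm_nonneg)
qed

section \<open>Closure properties of positive semidefinite matrices\<close>

lemma pos_def_imp_pos_semidef_mat:
  assumes "pos_def_mat A"
  shows "pos_semidef_mat A"
  unfolding pos_semidef_mat_def
proof (intro conjI ballI)
  show "hermitian_mat A" using assms by (simp add: pos_def_mat_def)
  fix x :: "complex vec" assume x: "x \<in> carrier_vec (dim_row A)"
  show "0 \<le> (A *\<^sub>v x) \<bullet>c x"
  proof (cases "x = 0\<^sub>v (dim_row A)")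
    case True
    have "A *\<^sub>v x \<in> carrier_vec (dim_row A)"
      by (rule carrier_vecI) simp
    then have "(A *\<^sub>v x) \<bullet>c x = 0"
      unfolding True conjugate_zero_vec by (rule scalar_prod_right_zero)
    then show ?thesis by simp
  next
    case False
    then show ?thesis using assms x unfolding pos_def_mat_def by (blast intro: less_imp_le)
  qed
qed

lemma pos_semidef_mat_zero: "pos_semidef_mat (0\<^sub>m n n)"
  by (auto simp: pos_semidef_mat_def hermitian_mat_iff[of _ n] scalar_prod_def)

lemma pos_semidef_mat_add:
  assumes A: "A \<in> carrier_mat n n" "pos_semidef_mat A"
    and B: "B \<in> carrier_mat n n" "pos_semidef_mat B"
  shows "pos_semidef_mat (A + B)"
proof -
  have AB: "A + B \<in> carrier_mat n n" using A B by simp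
  have "hermitian_mat (A + B)"
    using A B unfolding pos_semidef_mat_def hermitian_mat_iff[OF AB] hermitian_mat_iff[OF A(1)]
      hermitian_mat_iff[OF B(1)] by auto
  moreover have "0 \<le> ((A + B) *\<^sub>v x) \<bullet>c x" if x: "x \<in> carrier_vec n" for x
  proof -
    have "((A + B) *\<^sub>v x) \<bullet>c x = (A *\<^sub>v x) \<bullet>c x + (B *\<^sub>v x) \<bullet>c x"
      using A B x by (simp add: add_mult_distrib_mat_vec[of A n n] add_scalar_prod_distrib[of _ n])
    then show ?thesis
      using A B x by (auto simp: pos_semidef_mat_def)
  qed
  ultimately show ?thesis
    using AB B by (simp add: pos_semidef_mat_def)
qed

lemma pos_semidef_mat_smult:
  assumes A: "A \<in> carrier_mat n n" "pos_semidef_mat A" and "c \<ge> 0"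
  shows "pos_semidef_mat (complex_of_real c \<cdot>\<^sub>m A)"
proof -
  have cA: "complex_of_real c \<cdot>\<^sub>m A \<in> carrier_mat n n" using A by simp
  have "hermitian_mat (complex_of_real c \<cdot>\<^sub>m A)"
    using A unfolding pos_semidef_mat_def hermitian_mat_iff[OF cA] hermitian_mat_iff[OF A(1)]
    by auto
  moreover have "0 \<le> ((complex_of_real c \<cdot>\<^sub>m A) *\<^sub>v x) \<bullet>c x" if x: "x \<in> carrier_vec n" for x
  proof -
    have "(complex_of_real c \<cdot>\<^sub>m A) *\<^sub>v x = complex_of_real c \<cdot>\<^sub>v (A *\<^sub>v x)"
      using A x by (intro eq_vecI) auto
    then have "((complex_of_real c \<cdot>\<^sub>m A) *\<^sub>v x) \<bullet>c x = complex_of_real c * ((A *\<^sub>v x) \<bullet>c x)"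
      using A x by simp
    moreover have "0 \<le> (A *\<^sub>v x) \<bullet>c x"
      using A x by (auto simp: pos_semidef_mat_def)
    ultimately show ?thesis
      using \<open>c \<ge> 0\<close> by (simp add: less_eq_complex_def)
  qed
  ultimately show ?thesis
    using A by (auto simp: pos_semidef_mat_def)
qed

lemma hermitian_mat_one: "hermitian_mat (1\<^sub>m n)"
  by (auto simp: hermitian_mat_iff[of _ n])

lemma pow_mat_commute:
  fixes A :: "'a :: semiring_1 mat"
  assumes A: "A \<in> carrier_mat n n"
  shows "A * A ^\<^sub>m k = A ^\<^sub>m k * A"
  by (induction k) (use A in \<open>auto simp flip: assoc_mult_mat[of A n n _ n A n]\<close>)

text \<open>The adjoint of \<open>A ^\<^sub>m k * A\<close> has the factors in reverse order, and
  \<open>pow_mat_commute\<close> restores the original one.\<close>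

lemma hermitian_mat_pow:
  assumes A: "A \<in> carrier_mat n n" and h: "hermitian_mat A"
  shows "hermitian_mat (A ^\<^sub>m k)"
proof (induction k)
  case 0
  then show ?case by (simp add: hermitian_mat_one)
next
  case (Suc k)
  let ?P = "A ^\<^sub>m k"
  have P: "?P \<in> carrier_mat n n" using A by simp
  have hA: "cnj (A $$ (j, i)) = A $$ (i, j)" and hP: "cnj (?P $$ (j, i)) = ?P $$ (i, j)"
    if "i < n" "j < n" for i j
    using that h Suc A P hermitian_mat_iff by blast+
  have "cnj ((?P * A) $$ (j, i)) = (?P * A) $$ (i, j)" if ij: "i < n" "j < n" for i j
  proof -
    have "(?P * A) $$ (i, j) = (\<Sum>l<n. ?P $$ (i, l) * A $$ (l, j))"
      using A P ij mult_mat_sum by blast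
    also have "\<dots> = (\<Sum>l<n. cnj (A $$ (j, l) * ?P $$ (l, i)))"
    proof (intro sum.cong refl)
      fix l assume "l \<in> {..<n}"
      then show "?P $$ (i, l) * A $$ (l, j) = cnj (A $$ (j, l) * ?P $$ (l, i))"
        using ij hP[of i l] hA[of l j] by simp
    qed
    also have "\<dots> = cnj ((A * ?P) $$ (j, i))"
      using A P ij by (simp add: mult_mat_sum[of A n n ?P n] del: index_mult_mat(1))
    finally show ?thesis by (simp add: pow_mat_commute[OF A])
  qed
  then show ?case
    using mult_carrier_mat[OF P A(1)]
    by (subst hermitian_mat_iff[of _ n]) (simp_all del: index_mult_mat(1))
qed

text \<open>
  Splitting \<open>k = 2 m\<close> or \<open>k = 2 m + 1\<close> writes \<open>\<langle>A\<^sup>k x, x\<rangle>\<close> as \<open>\<langle>y, y\<rangle>\<close> or \<open>\<langle>A y, y\<rangle>\<close>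
  with \<open>y = A\<^sup>m x\<close>.
\<close>

lemma pos_semidef_mat_pow:
  assumes A: "A \<in> carrier_mat n n" "pos_semidef_mat A"
  shows "pos_semidef_mat (A ^\<^sub>m k)"
proof -
  have h: "hermitian_mat A" using A by (simp add: pos_semidef_mat_def)
  have "0 \<le> (A ^\<^sub>m k *\<^sub>v x) \<bullet>c x" if x: "x \<in> carrier_vec n" for x
  proof -
    define m where "m = k div 2"
    let ?P = "A ^\<^sub>m m"
    have P: "?P \<in> carrier_mat n n" using A by simp
    have y: "?P *\<^sub>v x \<in> carrier_vec n" using mult_mat_vec_carrier[OF P x] .
    note swap = hermitian_mat_swap[OF P hermitian_mat_pow[OF A(1) h] _ x]
    have add: "A ^\<^sub>m (a + b) = A ^\<^sub>m a * A ^\<^sub>m b" for a b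
      using A by (induction b) (auto simp: assoc_mult_mat[of _ n n _ n _ n])
    show ?thesis
    proof (cases "even k")
      case True
      then have "k = m + m" by (auto simp: m_def)
      then have "(A ^\<^sub>m k *\<^sub>v x) \<bullet>c x = (?P *\<^sub>v x) \<bullet>c (?P *\<^sub>v x)"
        using swap[OF y] P x by (simp add: add assoc_mult_mat_vec[of _ n n _ n])
      then show ?thesis by (simp add: conjugate_square_ge_0_vec)
    next
      case False
      then have "k = m + (1 + m)" by (auto simp: m_def elim: oddE)
      then have "A ^\<^sub>m k = ?P * (A * ?P)"
        using A by (simp only: add) simp
      then have "(A ^\<^sub>m k *\<^sub>v x) \<bullet>c x = (A *\<^sub>v (?P *\<^sub>v x)) \<bullet>c (?P *\<^sub>v x)"
        using swap[of "A *\<^sub>v (?P *\<^sub>v x)"] A P x y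
        by (simp add: assoc_mult_mat_vec[of _ n n _ n])
      then show ?thesis
        using A y by (auto simp: pos_semidef_mat_def)
    qed
  qed
  then show ?thesis
    using A hermitian_mat_pow[OF A(1) h] by (auto simp: pos_semidef_mat_def)
qed

section \<open>Sums of matrices and the norm bound\<close>

text \<open>The three claims share one induction: adding a summand uses membership in the carrier
  and semidefiniteness of the partial sum, and the norm bound is the triangle inequality.\<close>

lemma finsum_pos_semidef_mat:
  assumes "finite I" and "\<And>i. i \<in> I \<Longrightarrow> f i \<in> carrier_mat n n"
    and "\<And>i. i \<in> I \<Longrightarrow> pos_semidef_mat (f i)"
  shows "(\<Oplus>\<^bsub>ring_mat TYPE(complex) n ()\<^esub>i\<in>I. f i) \<in> carrier_mat n n
    \<and> pos_semidef_mat (\<Oplus>\<^bsub>ring_mat TYPE(complex) n ()\<^esub>i\<in>I. f i)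
    \<and> frobenius_norm (\<Oplus>\<^bsub>ring_mat TYPE(complex) n ()\<^esub>i\<in>I. f i) \<le> (\<Sum>i\<in>I. frobenius_norm (f i))"
  using assms
proof (induction I)
  case empty
  interpret ring "ring_mat TYPE(complex) n ()" by (rule ring_mat)
  show ?case
    using frobenius_norm_eq_0_iff[of "0\<^sub>m n n" n n]
    by (simp add: ring_mat_simps pos_semidef_mat_zero)
next
  case (insert i I)
  interpret ring "ring_mat TYPE(complex) n ()" by (rule ring_mat)
  let ?S = "\<Oplus>\<^bsub>ring_mat TYPE(complex) n ()\<^esub>i\<in>I. f i"
  have S: "?S \<in> carrier_mat n n" "pos_semidef_mat ?S"
      "frobenius_norm ?S \<le> (\<Sum>i\<in>I. frobenius_norm (f i))"
    using insert by auto
  have "(\<Oplus>\<^bsub>ring_mat TYPE(complex) n ()\<^esub>i\<in>insert i I. f i) = f i + ?S"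
    using insert by (subst finsum_insert) (auto simp: ring_mat_simps)
  then show ?case
    using insert S pos_semidef_mat_add[of "f i" n ?S] frobenius_norm_add[of "f i" n n ?S]
    by simp
qed

text \<open>For \<open>v = 1\<close> both sides equal \<open>hs_norm A\<close>, so strictness fails.
  For \<open>hs_norm A = 1\<close> the quotient is 0 by the convention on division by zero.\<close>

theorem theorem5p2:
  fixes v :: nat and A :: "complex mat"
  assumes "v \<ge> 2"
    and "A \<in> carrier_mat v v"
    and "pos_def_mat A"
    and "hs_norm A \<noteq> 1"
  shows "hs_norm (\<Oplus>\<^bsub>ring_mat TYPE(complex) v ()\<^esub>k\<in>{1..v}.
             complex_of_real (sqrt (real k)) \<cdot>\<^sub>m (A ^\<^sub>m k))
         < real v * (real v + 1) * (sqrt (real v) - 0.5) * (hs_norm A - hs_norm A ^ (v + 1))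
             / (1 - hs_norm A)"
proof -
  let ?f = "\<lambda>k. complex_of_real (sqrt (real k)) \<cdot>\<^sub>m (A ^\<^sub>m k)"
  let ?S = "\<Oplus>\<^bsub>ring_mat TYPE(complex) v ()\<^esub>k\<in>{1..v}. ?f k"
  define a where "a = hs_norm A"
  have psd: "pos_semidef_mat A"
    using assms by (simp add: pos_def_imp_pos_semidef_mat)
  then have a: "a = frobenius_norm A"
    using assms hs_norm_pos_semidef by (simp add: a_def)
  have "A \<noteq> 0\<^sub>m v v"
  proof
    assume "A = 0\<^sub>m v v"
    \<comment> \<open>A nonzero test vector, available because \<open>v > 0\<close>, on which the
      zero matrix violates definiteness.\<close>
    moreover have "unit_vec v 0 \<noteq> (0\<^sub>v v :: complex vec)"
      using assms(1) by (auto simp: vec_eq_iff unit_vec_def intro!: exI[of _ 0])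
    ultimately have "0 < (0\<^sub>m v v *\<^sub>v unit_vec v 0) \<bullet>c (unit_vec v 0 :: complex vec)"
      using assms(3) unfolding pos_def_mat_def by force
    then show False by (simp add: scalar_prod_def)
  qed
  then have "a > 0"
    using frobenius_norm_nonneg[of A] frobenius_norm_eq_0_iff[OF assms(2)] unfolding a by linarith
  have f: "?f k \<in> carrier_mat v v" "pos_semidef_mat (?f k)" for k
    using assms(2) psd by (auto intro!: pos_semidef_mat_smult[of _ v] pos_semidef_mat_pow[of _ v])
  have S: "?S \<in> carrier_mat v v" "pos_semidef_mat ?S"
      "frobenius_norm ?S \<le> (\<Sum>k\<in>{1..v}. frobenius_norm (?f k))"
    using finsum_pos_semidef_mat[of "{1..v}" ?f v, OF finite_atLeastAtMost f] by auto
  have "hs_norm ?S \<le> (\<Sum>k\<in>{1..v}. frobenius_norm (?f k))"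
    using hs_norm_pos_semidef[OF S(1,2)] S(3) by simp
  also have "\<dots> \<le> (\<Sum>k\<in>{1..v}. sqrt v * a ^ k)"
  proof (intro sum_mono)
    fix k assume k: "k \<in> {1..v}"
    have "frobenius_norm (?f k) = sqrt k * frobenius_norm (A ^\<^sub>m k)"
      by (simp add: frobenius_norm_smult)
    also have "\<dots> \<le> sqrt v * a ^ k"
      using k frobenius_norm_pow[OF assms(2), of k]
      by (intro mult_mono) (auto simp: a frobenius_norm_nonneg)
    finally show "frobenius_norm (?f k) \<le> sqrt v * a ^ k" .
  qed
  also have "\<dots> = sqrt v * (\<Sum>k\<in>{1..v}. a ^ k)"
    by (simp add: sum_distrib_left)
  also have "\<dots> < real v * (real v + 1) * (sqrt v - 0.5) * (\<Sum>k\<in>{1..v}. a ^ k)"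
  proof (rule mult_strict_right_mono)
    \<comment> \<open>The constant 6 is the value of \<open>v * (v + 1)\<close> at
      \<open>v = 2\<close>; the inequality \<open>x < 6 * (x - 0.5)\<close> amounts to
      \<open>x > 0.6\<close>.\<close>
    have "sqrt v \<ge> 1" using assms(1) by simp
    moreover have "x < 6 * (x - 0.5)" "0 \<le> x - 0.5" if "x \<ge> 1" for x :: real
      using that by simp_all
    ultimately have nonneg: "0 \<le> sqrt v - 0.5" and "sqrt v < 6 * (sqrt v - 0.5)" by blast+
    note this(2)
    also have "\<dots> \<le> (real v * (real v + 1)) * (sqrt v - 0.5)"
    proof (rule mult_right_mono)
      show "6 \<le> real v * (real v + 1)"
        using assms(1) mult_mono[of 2 "real v" 3 "real v + 1"] by simp
    qed (fact nonneg)
    finally show "sqrt v < real v * (real v + 1) * (sqrt v - 0.5)" .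
    show "0 < (\<Sum>k\<in>{1..v}. a ^ k)"
      using \<open>a > 0\<close> assms(1) by (intro sum_pos) auto
  qed
  \<comment> \<open>The geometric sum covers \<open>a > 1\<close> as well: numerator and denominator
    are then both negative.\<close>
  also have "(\<Sum>k\<in>{1..v}. a ^ k) = (a - a ^ (v + 1)) / (1 - a)"
    using sum_gp[of a 1 v] assms(1,4) by (simp add: a_def)
  finally show ?thesis by (simp add: a_def)
qed

end
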